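(* Let $Q$, $A$, $B$, $C_Q$, $c(t)$, $c^\perp(t)$ be as in the context. Let $c_1,c_2\in C_Q$, $b\in\mathbb{R}^2$, and let $a\in\mathbb{R}^2$ be such that $Q(\nu)\neq0$ for all $\nu\in a+\mathbb{Z}^2$. Then, as functions on $\mathbb{H}$, \begin{equation*} \widehat{\Phi}_{a,b}^{c_1,c_2} = \Phi_{a,b}^{c_1,c_2} + \phi_{a,b}^{c_1} - \phi_{a,b}^{c_2}. \end{equation*}
   Context: $A$ is a symmetric $2\times 2$ integer matrix such that $Q(\nu)=\frac12\nu^tA\nu$ on $\mathbb{R}^2$ has signature $(1,1)$; $B(\nu,\mu)=\nu^tA\mu$. $C_Q$ is a fixed one of the two components of $\{c\in\mathbb{R}^2:Q(c)=-1\}$. Choose $P\in\mathrm{GL}_2(\mathbb{R})$ with $A=P^t\begin{pmatrix}0&1\\1&0\end{pmatrix}P$ and $P^{-1}\binom{1}{-1}\in C_Q$; set $c(t)=P^{-1}\binom{e^t}{-e^{-t}}$, $c^\perp(t)=P^{-1}\binom{e^t}{e^{-t}}$. For $c_i\in C_Q$, $t_i$ is defined by $c(t_i)=c_i$ and $c_i^\perp:=c^\perp(t_i)$. $K_0$ is the modified Bessel function of the second kind, $\tau=x+iy\in\mathbb{H}$, $q=e^{2\pi i\tau}$, $\mathrm{sgn}(0)=0$. Define \begin{equation*} \begin{split} \Phi_{a,b}^{c_1,c_2}(\tau)&=\mathrm{sgn}(t_2-t_1)\,y^{1/2}\sum_{\nu\in a+\mathbb{Z}^2}\tfrac12\bigl[1-\mathrm{sgn}(B(\nu,c_1)B(\nu,c_2))\bigr]e^{2\pi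 iQ(\nu)x}e^{2\pi iB(\nu,b)}K_0(2\pi Q(\nu)y)\\ &\quad+\mathrm{sgn}(t_2-t_1)\,y^{1/2}\sum_{\nu\in a+\mathbb{Z}^2}\tfrac12\bigl[1-\mathrm{sgn}(B(\nu,c_1^\perp)B(\nu,c_2^\perp))\bigr]e^{2\pi iQ(\nu)x}e^{2\pi iB(\nu,b)}K_0(-2\pi Q(\nu)y), \end{split} \end{equation*} \begin{equation*} \widehat{\Phi}^{c_1,c_2}_{a,b}(\tau)=y^{1/2}\sum_{\nu\in a+\mathbb{Z}^2} q^{Q(\nu)}e^{2\pi iB(\nu,b)}\int_{t_1}^{t_2}e^{-\pi yB(\nu,c(t))^2}\,dt, \end{equation*} and for $c_0=c(t_0)\in C_Q$, $c_0^\perp=c^\perp(t_0)$, \begin{equation*} \phi_{a,b}^{c_0}(\tau)=y^{1/2}\sum_{\nu\in a+\mathbb{Z}^2}\alpha_{t_0}(\nu y^{1/2})\,q^{Q(\nu)}e^{2\pi iB(\nu,b)}, \end{equation*} where $\alpha_{t_0}(\nu)=\int_{t_0}^\infty e^{-\pi B(\nu,c(t))^2}dt$ if $B(\nu,c_0)B(\nu,c_0^\perp)>0$, $\alpha_{t_0}(\nu)=-\int_{-\infty}^{t_0}e^{-\pi B(\nu,c(t))^2}dt$ if $B(\nu,c_0)B(\nu,c_0^\perp)<0$, and $\alpha_{t_0}(\nu)=0$ if $B(\nu,c_0)B(\nu,c_0^\perp)=0$. *)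

theory Defs
  imports "HOL-Analysis.Analysis"
begin

text \<open>
  Indices of inertia of a quadratic form \<open>q\<close>: the maximal dimension of a subspace on which
  \<open>q\<close> is positive definite, and likewise for \<open>- q\<close>.
\<close>

definition positive_index :: "('a::euclidean_space \<Rightarrow> real) \<Rightarrow> nat" where
  "positive_index q = Max {dim V | V. subspace V \<and> (\<forall>v\<in>V. v \<noteq> 0 \<longrightarrow> q v > 0)}"

definition has_signature :: "('a::euclidean_space \<Rightarrow> real) \<Rightarrow> nat \<Rightarrow> nat \<Rightarrow> bool" where
  "has_signature q m n \<longleftrightarrow> positive_index q = m \<and> positive_index (\<lambda>v. - q v) = n"

definition bilin :: "int^2^2 \<Rightarrow> real^2 \<Rightarrow> real^2 \<Rightarrow> real" where
  "bilin A \<nu> \<mu> = \<nu> \<bullet> (map_matrix real_of_int A *v \<mu>)"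

definition quad :: "int^2^2 \<Rightarrow> real^2 \<Rightarrow> real" where
  "quad A \<nu> = 1 / 2 * (\<nu> \<bullet> (map_matrix real_of_int A *v \<nu>))"

definition hyp_matrix :: "real^2^2" where
  "hyp_matrix = vector [vector [0, 1], vector [1, 0]]"

definition c_curve :: "real^2^2 \<Rightarrow> real \<Rightarrow> real^2" where
  "c_curve P t = matrix_inv P *v vector [exp t, - exp (- t)]"

definition c_perp_curve :: "real^2^2 \<Rightarrow> real \<Rightarrow> real^2" where
  "c_perp_curve P t = matrix_inv P *v vector [exp t, exp (- t)]"

definition c_param :: "real^2^2 \<Rightarrow> real^2 \<Rightarrow> real" where
  "c_param P c = (THE t. c_curve P t = c)"

definition c_perp :: "real^2^2 \<Rightarrow> real^2 \<Rightarrow> real^2" where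
  "c_perp P c = c_perp_curve P (c_param P c)"

definition lattice_coset :: "real^2 \<Rightarrow> (real^2) set" where
  "lattice_coset a = (+) a ` {m. \<forall>i. m $ i \<in> \<int>}"

text \<open>
  The modified Bessel function \<open>K\<^sub>0\<close> for positive real argument. Only positive arguments
  matter below: in both sums defining \<open>Phi\<close> the bracketed coefficient vanishes at every
  \<open>\<nu>\<close> with \<open>quad A \<nu> \<noteq> 0\<close> for which the argument is negative.
\<close>

definition bessel_K0 :: "real \<Rightarrow> real" where
  "bessel_K0 x = (LBINT u=0..\<infinity>. exp (- x * cosh u))"

text \<open>
  \<open>qpow \<tau> r\<close> is \<open>q\<close> to the power \<open>r\<close> with \<open>q = exp (2 \<pi> \<i> \<tau>)\<close>; for non-integral \<open>r\<close> this
  is not the principal branch \<open>q powr r\<close>.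
\<close>

definition qpow :: "complex \<Rightarrow> real \<Rightarrow> complex" where
  "qpow \<tau> r = exp (2 * of_real pi * \<i> * \<tau> * of_real r)"

definition e2pi :: "real \<Rightarrow> complex" where
  "e2pi r = exp (2 * of_real pi * \<i> * of_real r)"

definition Phi ::
  "int^2^2 \<Rightarrow> real^2^2 \<Rightarrow> real^2 \<Rightarrow> real^2 \<Rightarrow> real^2 \<Rightarrow> real^2 \<Rightarrow> complex \<Rightarrow> complex" where
  "Phi A P a b c1 c2 \<tau> =
     of_real (sgn (c_param P c2 - c_param P c1) * sqrt (Im \<tau>)) *
       (\<Sum>\<^sub>\<infinity>\<nu>\<in>lattice_coset a.
          of_real (1 / 2 * (1 - sgn (bilin A \<nu> c1 * bilin A \<nu> c2))) *
          e2pi (quad A \<nu> * Re \<tau>) * e2pi (bilin A \<nu> b) *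
          of_real (bessel_K0 (2 * pi * quad A \<nu> * Im \<tau>)))
     + of_real (sgn (c_param P c2 - c_param P c1) * sqrt (Im \<tau>)) *
       (\<Sum>\<^sub>\<infinity>\<nu>\<in>lattice_coset a.
          of_real (1 / 2 * (1 - sgn (bilin A \<nu> (c_perp P c1) * bilin A \<nu> (c_perp P c2)))) *
          e2pi (quad A \<nu> * Re \<tau>) * e2pi (bilin A \<nu> b) *
          of_real (bessel_K0 (- 2 * pi * quad A \<nu> * Im \<tau>)))"

definition Phi_hat ::
  "int^2^2 \<Rightarrow> real^2^2 \<Rightarrow> real^2 \<Rightarrow> real^2 \<Rightarrow> real^2 \<Rightarrow> real^2 \<Rightarrow> complex \<Rightarrow> complex" where
  "Phi_hat A P a b c1 c2 \<tau> =
     of_real (sqrt (Im \<tau>)) *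
       (\<Sum>\<^sub>\<infinity>\<nu>\<in>lattice_coset a.
          qpow \<tau> (quad A \<nu>) * e2pi (bilin A \<nu> b) *
          of_real (LBINT t=ereal (c_param P c1)..ereal (c_param P c2).
                     exp (- pi * Im \<tau> * (bilin A \<nu> (c_curve P t))\<^sup>2)))"

definition alpha :: "int^2^2 \<Rightarrow> real^2^2 \<Rightarrow> real \<Rightarrow> real^2 \<Rightarrow> real" where
  "alpha A P t0 \<nu> =
     (let s = bilin A \<nu> (c_curve P t0) * bilin A \<nu> (c_perp_curve P t0) in
      if s > 0 then (LBINT t=ereal t0..\<infinity>. exp (- pi * (bilin A \<nu> (c_curve P t))\<^sup>2))
      else if s < 0 then - (LBINT t=-\<infinity>..ereal t0. exp (- pi * (bilin A \<nu> (c_curve P t))\<^sup>2))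
      else 0)"

definition phi ::
  "int^2^2 \<Rightarrow> real^2^2 \<Rightarrow> real^2 \<Rightarrow> real^2 \<Rightarrow> real^2 \<Rightarrow> complex \<Rightarrow> complex" where
  "phi A P a b c0 \<tau> =
     of_real (sqrt (Im \<tau>)) *
       (\<Sum>\<^sub>\<infinity>\<nu>\<in>lattice_coset a.
          of_real (alpha A P (c_param P c0) (sqrt (Im \<tau>) *\<^sub>R \<nu>)) *
          qpow \<tau> (quad A \<nu>) * e2pi (bilin A \<nu> b))"

end

theory Submission
  imports Defs
begin

text \<open>
  In the coordinates \<open>(u, v) = P \<nu>\<close> we have \<open>Q(\<nu>) = u v\<close>, \<open>B(\<nu>, c(t)) = v e\<^sup>t - u e\<^sup>-\<^sup>t\<close> and
  \<open>B(\<nu>, c\<^sup>\<bottom>(t)) = v e\<^sup>t + u e\<^sup>-\<^sup>t\<close>. Absorb \<open>y\<^sup>1\<^sup>/\<^sup>2\<close> into \<open>\<nu>\<close>. Multiplying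
  \<open>exp (- \<pi> B(\<nu>, c(t))\<^sup>2)\<close> by \<open>exp (- 2 \<pi> Q(\<nu>))\<close> cancels the indefinite part and leaves the weight
  \<open>exp (- \<pi> (v\<^sup>2 e\<^sup>2\<^sup>t + u\<^sup>2 e\<^sup>-\<^sup>2\<^sup>t))\<close>, which is symmetric about the point \<open>s\<close> where
  \<open>\<bar>v\<bar> e\<^sup>s = \<bar>u\<bar> e\<^sup>-\<^sup>s\<close>; its integral over either half line bounded by \<open>s\<close> is
  \<open>K\<^sub>0(2 \<pi> \<bar>u v\<bar>) / 2\<close>. The function \<open>\<alpha>\<close> at \<open>t\<^sub>0\<close> integrates from \<open>t\<^sub>0\<close> away from \<open>s\<close>, so the
  integral from \<open>t\<^sub>1\<close> to \<open>t\<^sub>2\<close> differs from the two \<open>\<alpha>\<close>-terms by \<open>K\<^sub>0\<close> times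
  \<open>(sgn (t\<^sub>2 - s) - sgn (t\<^sub>1 - s)) / 2\<close>. This is the coefficient in the first sum of \<open>\<Phi>\<close> if
  \<open>u v > 0\<close> and in the second if \<open>u v < 0\<close>, the other coefficient being zero. The identity thus
  holds term by term. Gaussian bounds make the \<open>\<alpha>\<close>-series and the series of integrals converge
  absolutely, and by the termwise identity so do the two \<open>K\<^sub>0\<close>-series, whose supports are disjoint.
\<close>

subsection \<open>The Gaussian weight and its tails\<close>

definition hyp_majorant :: "real \<Rightarrow> real \<Rightarrow> real \<Rightarrow> real" where
  "hyp_majorant x y t = (x * exp t)\<^sup>2 + (y * exp (- t))\<^sup>2"

lemma hyp_majorant_ge:
  assumes "\<bar>t\<bar> \<le> T"
  shows "exp (- 2 * T) * (x\<^sup>2 + y\<^sup>2) \<le> hyp_majorant x y t"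
proof -
  have "exp (- 2 * T) \<le> (exp t)\<^sup>2" "exp (- 2 * T) \<le> (exp (- t))\<^sup>2"
    using assms by (simp_all flip: exp_double)
  then have "x\<^sup>2 * exp (- 2 * T) + y\<^sup>2 * exp (- 2 * T) \<le> x\<^sup>2 * (exp t)\<^sup>2 + y\<^sup>2 * (exp (- t))\<^sup>2"
    by (intro add_mono mult_left_mono) auto
  then show ?thesis
    by (simp add: hyp_majorant_def power_mult_distrib algebra_simps)
qed

definition hyp_gauss :: "real \<Rightarrow> real \<Rightarrow> real \<Rightarrow> real" where
  "hyp_gauss x y t = exp (- hyp_majorant x y t)"

lemma hyp_gauss_pos: "hyp_gauss x y t > 0"
  by (simp add: hyp_gauss_def)

lemma borel_measurable_hyp_gauss [measurable]: "hyp_gauss x y \<in> borel_measurable borel"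
  unfolding hyp_gauss_def hyp_majorant_def by measurable

lemma continuous_on_hyp_gauss: "continuous_on S (hyp_gauss x y)"
  unfolding hyp_gauss_def hyp_majorant_def by (intro continuous_intros)

lemma hyp_gauss_minus: "hyp_gauss x y (- t) = hyp_gauss y x t"
  by (simp add: hyp_gauss_def hyp_majorant_def add.commute)

lemma hyp_gauss_add: "hyp_gauss x y (s + t) = hyp_gauss (x * exp s) (y * exp (- s)) t"
  by (simp add: hyp_gauss_def hyp_majorant_def mult.assoc flip: exp_add)

lemma exp_minus_diff_square:
  "exp (- (x * exp t - y * exp (- t))\<^sup>2) = exp (2 * (x * y)) * hyp_gauss x y t"
proof -
  have "exp t * exp (- t) = 1"
    by (simp flip: exp_add)
  then have "(x * exp t - y * exp (- t))\<^sup>2 = hyp_majorant x y t - 2 * (x * y)"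
    unfolding hyp_majorant_def by algebra
  then show ?thesis
    by (simp add: hyp_gauss_def flip: exp_add)
qed

lemma abs_interval_integral_hyp_gauss_le:
  fixes t1 t2 :: real
  shows "\<bar>LBINT t=t1..t2. hyp_gauss x y t\<bar>
    \<le> \<bar>t2 - t1\<bar> * exp (- (exp (- 2 * (\<bar>t1\<bar> + \<bar>t2\<bar>)) * (x\<^sup>2 + y\<^sup>2)))"
proof (induction t1 t2 rule: linorder_wlog)
  case (le t1 t2)
  let ?C = "exp (- (exp (- 2 * (\<bar>t1\<bar> + \<bar>t2\<bar>)) * (x\<^sup>2 + y\<^sup>2)))"
  have "(LBINT t=t1..t2. hyp_gauss x y t) = integral {t1..t2} (hyp_gauss x y)"
    using le by (intro interval_integral_eq_integral borel_integrable_atLeastAtMost'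
        continuous_on_hyp_gauss)
  also have "norm \<dots> \<le> ?C * (t2 - t1)"
  proof (intro integral_bound continuous_on_hyp_gauss)
    fix t assume "t \<in> {t1..t2}"
    then have "\<bar>t\<bar> \<le> \<bar>t1\<bar> + \<bar>t2\<bar>" by auto
    from hyp_majorant_ge[OF this, of x y] show "norm (hyp_gauss x y t) \<le> ?C"
      by (simp add: hyp_gauss_def)
  qed (fact le)
  finally show ?case using le by (simp add: mult.commute)
next
  case (sym t1 t2)
  then show ?case
    by (simp add: interval_integral_endpoints_reverse[of t1 t2] abs_minus_commute add.commute)
qed

lemma exp_minus_to_infinity:
  fixes a c :: real
  assumes "a > 0"
  shows set_integrable_exp_minus_Ioi: "set_integrable lborel {c<..} (\<lambda>t. exp (- a * t))"
    and interval_integral_exp_minus_to_infinity: "(LBINT t=c..\<infinity>. exp (- a * t)) = exp (- a * c) / a"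
proof -
  have integral: "((\<lambda>t. exp (- a * t)) has_integral exp (- a * c) / a) {c<..}"
    using has_integral_exp_minus_to_infinity[OF assms, of c]
    by (subst has_integral_spike_set_eq[where T = "{c..}"])
       (auto intro: negligible_subset[OF negligible_sing[of c]])
  then have "(\<lambda>t. exp (- a * t)) absolutely_integrable_on {c<..}"
    by (intro nonnegative_absolutely_integrable_1) auto
  then show int: "set_integrable lborel {c<..} (\<lambda>t. exp (- a * t))"
    unfolding set_integrable_def by (subst (asm) integrable_completion) auto
  show "(LBINT t=c..\<infinity>. exp (- a * t)) = exp (- a * c) / a"
    using set_borel_integral_eq_integral(2)[OF int] integral
    by (simp add: interval_integral_to_infinity_eq integral_unique)
qed

lemma hyp_gauss_le_exp_tangent:
  "hyp_gauss x y t \<le> exp (- ((x * exp s)\<^sup>2 * (1 + 2 * (t - s))))"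
proof -
  have "(x * exp s)\<^sup>2 * (1 + 2 * (t - s)) \<le> (x * exp s)\<^sup>2 * exp (2 * (t - s))"
    by (intro mult_left_mono exp_ge_add_one_self) simp
  also have "\<dots> = (x * exp t)\<^sup>2"
    by (simp add: power_mult_distrib flip: exp_double exp_add)
  also have "\<dots> \<le> hyp_majorant x y t"
    by (simp add: hyp_majorant_def)
  finally show ?thesis
    by (simp add: hyp_gauss_def)
qed

lemma hyp_gauss_to_infinity:
  fixes t0 :: real
  assumes "x \<noteq> 0"
  shows set_integrable_hyp_gauss_Ioi: "set_integrable lborel {t0<..} (hyp_gauss x y)"
    and interval_integral_hyp_gauss_to_infinity_le:
      "(LBINT t=t0..\<infinity>. hyp_gauss x y t) \<le> exp (- (x * exp t0)\<^sup>2) / (2 * (x * exp t0)\<^sup>2)"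
proof -
  define z where "z = (x * exp t0)\<^sup>2"
  have z: "z > 0" using assms by (simp add: z_def)
  let ?f = "\<lambda>t. exp (z * (2 * t0 - 1)) * exp (- (2 * z) * t)"
  have tangent: "hyp_gauss x y t \<le> ?f t" for t
    using hyp_gauss_le_exp_tangent[of x y t t0]
    by (simp add: z_def algebra_simps flip: exp_add)
  have f: "set_integrable lborel {t0<..} ?f"
    using z by (intro set_integrable_mult_right set_integrable_exp_minus_Ioi) auto
  show int: "set_integrable lborel {t0<..} (hyp_gauss x y)"
    by (rule set_integrable_bound[OF f])
       (use tangent in \<open>auto simp: set_borel_measurable_def abs_of_pos hyp_gauss_pos\<close>)
  have "(LBINT t=t0..\<infinity>. hyp_gauss x y t) \<le> (LBINT t=t0..\<infinity>. ?f t)"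
    unfolding interval_integral_to_infinity_eq by (intro set_integral_mono int f tangent)
  also have "\<dots> = exp (z * (2 * t0 - 1)) * (exp (- (2 * z) * t0) / (2 * z))"
    using z by (simp only: interval_lebesgue_integral_mult_right
        interval_integral_exp_minus_to_infinity)
  also have "\<dots> = exp (- z) / (2 * z)"
    by (simp add: algebra_simps flip: exp_add)
  finally show "(LBINT t=t0..\<infinity>. hyp_gauss x y t) \<le> exp (- (x * exp t0)\<^sup>2) / (2 * (x * exp t0)\<^sup>2)"
    by (simp add: z_def)
qed

lemma interval_integral_hyp_gauss_nonneg: "0 \<le> (LBINT t=ereal t0..\<infinity>. hyp_gauss x y t)"
  unfolding interval_integral_to_infinity_eq set_lebesgue_integral_def
  by (intro integral_nonneg_AE AE_I2) (simp add: less_imp_le[OF hyp_gauss_pos])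

lemma interval_integral_hyp_gauss_reflect:
  "(LBINT t=p..q. hyp_gauss x y t) = (LBINT t=-q..-p. hyp_gauss y x t)"
  by (subst interval_integral_reflect) (simp add: hyp_gauss_minus)

lemma integrable_hyp_gauss:
  assumes "x \<noteq> 0" "y \<noteq> 0"
  shows "integrable lborel (hyp_gauss x y)"
proof -
  have "set_integrable lborel {..<0} (hyp_gauss x y)"
    using set_integrable_hyp_gauss_Ioi[OF assms(2), of 0 x] unfolding set_integrable_def
    by (subst (asm) lborel_integrable_real_affine_iff[where c = "-1" and t = 0, symmetric])
       (auto simp: hyp_gauss_minus indicator_def)
  with set_integrable_hyp_gauss_Ioi[OF assms(1), of "-1" y]
  have "set_integrable lborel ({-1<..} \<union> {..<0}) (hyp_gauss x y)"
    by (intro set_integrable_Un) auto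
  also have "{-1<..} \<union> {..<0} = (UNIV :: real set)" by auto
  finally show ?thesis by (simp add: set_integrable_def)
qed

lemma interval_integral_sum_of_integrable:
  fixes f :: "real \<Rightarrow> 'a::{banach, second_countable_topology}"
  assumes "integrable lborel f"
  shows "(LBINT t=p..q. f t) + (LBINT t=q..r. f t) = (LBINT t=p..r. f t)"
proof (rule interval_integral_sum)
  have "set_integrable lborel S f" if "S \<in> sets borel" for S
    using integrable_mult_indicator[OF _ assms, of S] that by (simp add: set_integrable_def)
  then show "interval_lebesgue_integrable lborel (min p (min q r)) (max p (max q r)) f"
    by (auto simp: interval_lebesgue_integrable_def)
qed

subsection \<open>The point of symmetry\<close>

definition hyp_center :: "real \<Rightarrow> real \<Rightarrow> real" where
  "hyp_center x y = ln \<bar>y / x\<bar> / 2"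

lemma hyp_center_mult: "c \<noteq> 0 \<Longrightarrow> hyp_center (c * x) (c * y) = hyp_center x y"
  by (simp add: hyp_center_def)

lemma hyp_center_commute: "x \<noteq> 0 \<Longrightarrow> y \<noteq> 0 \<Longrightarrow> hyp_center y x = - hyp_center x y"
  by (simp add: hyp_center_def abs_divide ln_div diff_divide_distrib)

lemma exp_hyp_center_square:
  assumes "x \<noteq> 0" "y \<noteq> 0"
  shows "(exp (hyp_center x y))\<^sup>2 = \<bar>y / x\<bar>"
  using assms by (simp add: hyp_center_def flip: exp_double)

lemma hyp_center_balanced:
  assumes "x \<noteq> 0" "y \<noteq> 0"
  shows "(x * exp (hyp_center x y))\<^sup>2 = \<bar>x * y\<bar>" "(y * exp (- hyp_center x y))\<^sup>2 = \<bar>x * y\<bar>"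
proof -
  have "x\<^sup>2 * \<bar>y / x\<bar> = \<bar>x * y\<bar>" for x y :: real
    by (auto simp: abs_if power2_eq_square mult_less_0_iff divide_less_0_iff)
  then show "(x * exp (hyp_center x y))\<^sup>2 = \<bar>x * y\<bar>" "(y * exp (- hyp_center x y))\<^sup>2 = \<bar>x * y\<bar>"
    using assms exp_hyp_center_square[of x y] exp_hyp_center_square[of y x]
      hyp_center_commute[of x y]
    by (simp_all add: power_mult_distrib mult.commute[of x y])
qed

lemma sgn_exp_diff:
  assumes "x \<noteq> 0" "y \<noteq> 0"
  shows "sgn (x * exp t - y * exp (- t)) =
    sgn x * (if x * y > 0 then sgn (t - hyp_center x y) else 1)"
proof (cases "x * y > 0")
  case True
  define s where "s = hyp_center x y"
  have "\<bar>y / x\<bar> = y / x"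
    using True by (auto simp: abs_if divide_less_0_iff zero_less_mult_iff)
  then have "y = x * (exp s)\<^sup>2"
    using assms by (simp add: s_def exp_hyp_center_square del: abs_divide)
  then have "x * exp t - y * exp (- t) = x * exp s * (exp (t - s) - exp (- (t - s)))"
    by (simp add: algebra_simps flip: exp_add exp_double)
  also have "\<dots> = x * exp s * (2 * sinh (t - s))"
    by (simp add: sinh_def)
  finally show ?thesis
    using True by (simp add: sgn_mult sgn_if[of "sinh _"] sgn_if[of "t - _"] flip: s_def)
next
  case False
  then have "- (y / x) > 0"
    using assms by (auto simp: divide_less_0_iff zero_less_mult_iff)
  have "x * exp t - y * exp (- t) = x * (exp t + - (y / x) * exp (- t))"
    using assms by (simp add: field_simps)
  moreover have "exp t + - (y / x) * exp (- t) > 0"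
    by (intro add_pos_pos mult_pos_pos) (use \<open>- (y / x) > 0\<close> in auto)
  ultimately show ?thesis
    using False by (simp only: sgn_mult sgn_pos if_False)
qed

lemma sgn_exp_sum:
  assumes "x \<noteq> 0" "y \<noteq> 0"
  shows "sgn (x * exp t + y * exp (- t)) =
    sgn x * (if x * y < 0 then sgn (t - hyp_center x y) else 1)"
  using sgn_exp_diff[of x "- y" t] assms by (simp add: hyp_center_def)

lemma sgn_exp_diff_mult_sum:
  assumes "x \<noteq> 0" "y \<noteq> 0"
  shows "sgn ((x * exp t - y * exp (- t)) * (x * exp t + y * exp (- t))) = sgn (t - hyp_center x y)"
  using assms
  by (simp add: sgn_mult sgn_exp_diff sgn_exp_sum not_less le_less flip: sgn_mult[of x x])

lemma sgn_diff_times: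
  fixes a b :: "'a::linordered_idom"
  shows "sgn (b - a) * (1 - sgn a * sgn b) = sgn b - sgn a"
  by (auto simp: sgn_if)

lemma sgn_mult_sgn_cancel:
  fixes x :: "'a::linordered_idom"
  assumes "x \<noteq> 0"
  shows "sgn x * r * (sgn x * r') = r * r'"
proof -
  have "sgn x * sgn x = 1"
    using assms by (simp add: sgn_if)
  then show ?thesis by algebra
qed

lemma hyp_gauss_center_add:
  assumes "x \<noteq> 0" "y \<noteq> 0"
  shows "hyp_gauss x y (hyp_center x y + t) = exp (- (2 * \<bar>x * y\<bar>) * cosh (2 * t))"
proof -
  have "hyp_gauss x y (hyp_center x y + t) =
      exp (- (\<bar>x * y\<bar> * (exp t)\<^sup>2 + \<bar>x * y\<bar> * (exp (- t))\<^sup>2))"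
    using hyp_center_balanced[OF assms] unfolding hyp_gauss_add
    by (simp only: hyp_gauss_def hyp_majorant_def power_mult_distrib)
  then show ?thesis
    by (simp add: cosh_def algebra_simps flip: exp_double)
qed

lemma interval_integral_hyp_gauss_center_to_infinity:
  assumes "x \<noteq> 0" "y \<noteq> 0"
  shows "(LBINT t=hyp_center x y..\<infinity>. hyp_gauss x y t) = bessel_K0 (2 * \<bar>x * y\<bar>) / 2"
proof -
  let ?s = "hyp_center x y"
  have "(LBINT t=?s..\<infinity>. hyp_gauss x y t) = (\<integral>t. indicator {?s<..} t * hyp_gauss x y t \<partial>lborel)"
    by (simp add: interval_integral_to_infinity_eq set_lebesgue_integral_def)
  also have "\<dots> = 1 / 2 * (\<integral>r. indicator {0<..} r * exp (- (2 * \<bar>x * y\<bar>) * cosh r) \<partial>lborel)"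
    using hyp_gauss_center_add[OF assms]
    by (subst lborel_integral_real_affine[where c = "1 / 2" and t = ?s])
       (auto simp: indicator_def intro!: Bochner_Integration.integral_cong)
  also have "\<dots> = bessel_K0 (2 * \<bar>x * y\<bar>) / 2"
    by (simp add: bessel_K0_def zero_ereal_def interval_integral_to_infinity_eq
        set_lebesgue_integral_def)
  finally show ?thesis .
qed

lemma interval_integral_hyp_gauss_to_center:
  assumes "x \<noteq> 0" "y \<noteq> 0"
  shows "(LBINT t=-\<infinity>..hyp_center x y. hyp_gauss x y t) = bessel_K0 (2 * \<bar>x * y\<bar>) / 2"
  using interval_integral_hyp_gauss_center_to_infinity[OF assms(2,1)] hyp_center_commute[OF assms]
  by (subst interval_integral_hyp_gauss_reflect) (simp add: mult.commute)

definition hyp_tail :: "real \<Rightarrow> real \<Rightarrow> real \<Rightarrow> real" where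
  "hyp_tail x y t0 =
     (if t0 > hyp_center x y then LBINT t=t0..\<infinity>. hyp_gauss x y t
      else if t0 < hyp_center x y then - (LBINT t=-\<infinity>..t0. hyp_gauss x y t)
      else 0)"

lemma hyp_tail_eq:
  assumes "x \<noteq> 0" "y \<noteq> 0"
  defines "s \<equiv> hyp_center x y"
  shows "hyp_tail x y t =
    sgn (t - s) * bessel_K0 (2 * \<bar>x * y\<bar>) / 2 - (LBINT r=s..t. hyp_gauss x y r)"
proof -
  note sum = interval_integral_sum_of_integrable[OF integrable_hyp_gauss[OF assms(1,2)]]
  note half = interval_integral_hyp_gauss_center_to_infinity[OF assms(1,2), folded s_def]
    interval_integral_hyp_gauss_to_center[OF assms(1,2), folded s_def]
  show ?thesis
  proof (cases t s rule: linorder_cases)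
    case less
    then show ?thesis
      using sum[of "-\<infinity>" s t] half(2) by (simp add: hyp_tail_def flip: s_def)
  next
    case equal
    then show ?thesis
      by (simp add: hyp_tail_def flip: s_def)
  next
    case greater
    then show ?thesis
      using sum[of s t \<infinity>] half(1) by (simp add: hyp_tail_def flip: s_def)
  qed
qed

lemma interval_integral_hyp_gauss_eq:
  assumes "x \<noteq> 0" "y \<noteq> 0"
  shows "(LBINT t=ereal t1..ereal t2. hyp_gauss x y t) =
    (sgn (t2 - hyp_center x y) - sgn (t1 - hyp_center x y)) / 2 * bessel_K0 (2 * \<bar>x * y\<bar>)
      + hyp_tail x y t1 - hyp_tail x y t2"
  using interval_integral_sum_of_integrable[OF integrable_hyp_gauss[OF assms],
      of "hyp_center x y" t1 t2]
  unfolding hyp_tail_eq[OF assms] by (simp add: field_simps)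

lemma abs_hyp_tail_le:
  assumes "x \<noteq> 0" "y \<noteq> 0" and M: "0 < M" "M \<le> hyp_majorant x y t"
  shows "\<bar>hyp_tail x y t\<bar> \<le> exp (- M / 2) / M"
proof -
  have mono: "exp (- z) / (2 * z) \<le> exp (- M / 2) / M" if "M / 2 \<le> z" for z
    using that M(1) by (intro frac_le) auto
  have sgn: "sgn ((x * exp t)\<^sup>2 - (y * exp (- t))\<^sup>2) = sgn (t - hyp_center x y)"
    using sgn_exp_diff_mult_sum[OF assms(1,2)]
    by (simp add: power2_eq_square square_diff_square_factored mult.commute)
  show ?thesis
  proof (cases t "hyp_center x y" rule: linorder_cases)
    case less
    then have "(x * exp t)\<^sup>2 < (y * exp (- t))\<^sup>2"
      using sgn by (simp add: sgn_if split: if_splits)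
    with M have "M / 2 \<le> (y * exp (- t))\<^sup>2" by (simp add: hyp_majorant_def)
    from mono[OF this] show ?thesis
      using less interval_integral_hyp_gauss_nonneg
        interval_integral_hyp_gauss_to_infinity_le[OF assms(2), of "- t" x]
      by (simp add: hyp_tail_def interval_integral_hyp_gauss_reflect[of "-\<infinity>"])
  next
    case equal
    then show ?thesis
      using M by (simp add: hyp_tail_def)
  next
    case greater
    then have "(x * exp t)\<^sup>2 > (y * exp (- t))\<^sup>2"
      using sgn by (simp add: sgn_if split: if_splits)
    with M have "M / 2 \<le> (x * exp t)\<^sup>2" by (simp add: hyp_majorant_def)
    from mono[OF this] show ?thesis
      using greater interval_integral_hyp_gauss_nonneg
        interval_integral_hyp_gauss_to_infinity_le[OF assms(1), of t y]
      by (simp add: hyp_tail_def)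
  qed
qed

subsection \<open>Gaussian sums over lattice cosets\<close>

lemma summable_on_int_exp_abs:
  fixes c :: real
  assumes "c > 0"
  shows "(\<lambda>m::int. exp (- c * \<bar>real_of_int m\<bar>)) summable_on UNIV"
proof -
  let ?f = "\<lambda>m::int. exp (- c * \<bar>real_of_int m\<bar>)"
  have "summable (\<lambda>n. exp (- c) ^ n)"
    using assms by (intro summable_geometric) auto
  then have nat: "(\<lambda>n::nat. exp (- c * real n)) summable_on UNIV"
    by (simp add: summable_on_UNIV_nonneg_real_iff exp_of_nat_mult[symmetric] mult.commute)
  have "?f summable_on range int" "?f summable_on range (\<lambda>n. - int n)"
    using nat by (subst summable_on_reindex; simp add: o_def inj_def)+
  then have "?f summable_on (range int \<union> range (\<lambda>n. - int n))"
    by (rule summable_on_union)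
  also have "range int \<union> range (\<lambda>n. - int n) = UNIV"
    by (auto simp: image_def) (metis int_cases2)
  finally show ?thesis .
qed

lemma summable_on_int_gaussian:
  fixes k a :: real
  assumes "k > 0"
  shows "(\<lambda>m::int. exp (- k * (a + real_of_int m)\<^sup>2)) summable_on UNIV"
proof (rule summable_on_comparison_test)
  let ?C = "exp (k * (1 + 2 * \<bar>a\<bar>))"
  show "(\<lambda>m::int. ?C * exp (- (2 * k) * \<bar>real_of_int m\<bar>)) summable_on UNIV"
    using assms by (intro summable_on_cmult_right summable_on_int_exp_abs) auto
  fix m :: int
  have "2 * \<bar>real_of_int m\<bar> - 2 * \<bar>a\<bar> - 1 \<le> 2 * \<bar>a + real_of_int m\<bar> - 1"
    using abs_triangle_ineq[of "a + real_of_int m" "- a"] by simp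
  also have "\<dots> \<le> (a + real_of_int m)\<^sup>2"
    using zero_le_power2[of "\<bar>a + real_of_int m\<bar> - 1"] by (simp add: power2_diff)
  finally have "k * (2 * \<bar>real_of_int m\<bar> - 2 * \<bar>a\<bar> - 1) \<le> k * (a + real_of_int m)\<^sup>2"
    using assms by (intro mult_left_mono) auto
  then show "exp (- k * (a + real_of_int m)\<^sup>2) \<le> ?C * exp (- (2 * k) * \<bar>real_of_int m\<bar>)"
    by (simp add: algebra_simps flip: exp_add)
qed auto

lemma summable_on_times:
  fixes f :: "'a \<Rightarrow> real" and g :: "'b \<Rightarrow> real"
  assumes "f summable_on A" "g summable_on B" "\<And>x. x \<in> A \<Longrightarrow> 0 \<le> f x" "\<And>y. y \<in> B \<Longrightarrow> 0 \<le> g y"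
  shows "(\<lambda>(x, y). f x * g y) summable_on A \<times> B"
proof (rule summable_on_SigmaI)
  fix x
  show "((\<lambda>y. case (x, y) of (x, y) \<Rightarrow> f x * g y) has_sum (f x * infsum g B)) B"
    using assms(2) by (auto intro!: has_sum_cmult_right)
qed (use assms in \<open>auto intro!: summable_on_cmult_left\<close>)

lemma lattice_coset_eq_range:
  "lattice_coset a = range (\<lambda>(m, n). a + vector [real_of_int m, real_of_int n])"
proof (intro set_eqI iffI)
  fix \<nu> assume "\<nu> \<in> lattice_coset a"
  then obtain m where m: "\<nu> = a + m" "m $ 1 \<in> \<int>" "m $ 2 \<in> \<int>"
    by (auto simp: lattice_coset_def)
  then have "\<nu> = (\<lambda>(m, n). a + vector [real_of_int m, real_of_int n]) (\<lfloor>m $ 1\<rfloor>, \<lfloor>m $ 2\<rfloor>)"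
    by (auto simp: vec_eq_iff forall_2)
  then show "\<nu> \<in> range (\<lambda>(m, n). a + vector [real_of_int m, real_of_int n])"
    by blast
qed (auto simp: lattice_coset_def forall_2)

lemma summable_on_lattice_coset_gaussian:
  fixes f :: "real^2 \<Rightarrow> 'a::euclidean_space"
  assumes "linear f" "inj f" "k > 0"
  shows "(\<lambda>\<nu>. exp (- k * (norm (f \<nu>))\<^sup>2)) summable_on lattice_coset a"
proof -
  let ?h = "\<lambda>(m, n). a + vector [real_of_int m, real_of_int n]"
  have inj: "inj ?h"
    by (auto simp: inj_on_def vec_eq_iff forall_2)
  obtain B where B: "B > 0" "\<And>\<nu>. B * norm \<nu> \<le> norm (f \<nu>)"
    using linear_inj_bounded_below_pos[OF assms(1,2)] by blast
  define c where "c = k * B\<^sup>2"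
  let ?g = "\<lambda>i m. exp (- c * (a $ i + real_of_int m)\<^sup>2)"
  have "c > 0" using assms(3) B by (simp add: c_def)
  then have "(\<lambda>(m, n). ?g 1 m * ?g 2 n) summable_on UNIV"
    unfolding UNIV_Times_UNIV[symmetric]
    by (intro summable_on_times summable_on_int_gaussian) auto
  also have "(\<lambda>(m, n). ?g 1 m * ?g 2 n) = (\<lambda>\<nu>. exp (- c * (norm \<nu>)\<^sup>2)) \<circ> ?h"
    by (auto simp: fun_eq_iff norm_vec_def L2_set_def sum_2 algebra_simps simp flip: exp_add)
  finally have norm_summable: "(\<lambda>\<nu>. exp (- c * (norm \<nu>)\<^sup>2)) summable_on lattice_coset a"
    unfolding lattice_coset_eq_range summable_on_reindex[OF inj] .
  show ?thesis
  proof (rule summable_on_comparison_test[OF norm_summable])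
    fix \<nu> :: "real^2"
    have "c * (norm \<nu>)\<^sup>2 = k * (B * norm \<nu>)\<^sup>2"
      by (simp add: c_def power_mult_distrib)
    also have "\<dots> \<le> k * (norm (f \<nu>))\<^sup>2"
      using B assms(3) by (intro mult_left_mono power_mono) auto
    finally show "exp (- k * (norm (f \<nu>))\<^sup>2) \<le> exp (- c * (norm \<nu>)\<^sup>2)" by simp
  qed simp
qed

lemma finite_superlevel_of_summable_on:
  fixes g :: "'a \<Rightarrow> real"
  assumes "g summable_on A" "e > 0"
  shows "finite {x \<in> A. e \<le> g x}"
proof (rule ccontr)
  let ?F = "{x \<in> A. e \<le> g x}"
  assume "infinite ?F"
  moreover have "(\<lambda>_. e) summable_on ?F"
    by (rule summable_on_comparison_test[OF summable_on_subset[OF assms(1), of ?F]])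
       (use assms(2) in auto)
  ultimately show False
    using infsum_diverge_constant[of ?F e] assms(2) by simp
qed

lemma summable_on_comparison_test_small:
  fixes f :: "'a \<Rightarrow> 'b::banach" and g :: "'a \<Rightarrow> real"
  assumes "g summable_on A" "e > 0" and le: "\<And>x. x \<in> A \<Longrightarrow> g x < e \<Longrightarrow> norm (f x) \<le> g x"
  shows "f summable_on A"
proof -
  let ?F = "{x \<in> A. e \<le> g x}"
  have "(\<lambda>x. norm (f x)) summable_on A - ?F"
    by (rule Infinite_Sum.abs_summable_on_comparison_test'[OF summable_on_subset[OF assms(1)]])
       (use le in auto)
  then have "f summable_on A - ?F"
    by (rule abs_summable_summable)
  moreover have "f summable_on ?F"
    using finite_superlevel_of_summable_on[OF assms(1,2)] by (rule summable_on_finite)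
  ultimately have "f summable_on (A - ?F) \<union> ?F"
    by (rule summable_on_Un_disjoint) auto
  then show ?thesis
    by (simp add: Un_absorb2)
qed

subsection \<open>Theta series\<close>

lemma bilin_scaleR: "bilin A (r *\<^sub>R \<nu>) \<mu> = r * bilin A \<nu> \<mu>"
  by (simp add: bilin_def)

lemma quad_scaleR: "quad A (r *\<^sub>R \<nu>) = r\<^sup>2 * quad A \<nu>"
  by (simp add: quad_def matrix_vector_mult_scaleR power2_eq_square)

definition theta_series :: "int^2^2 \<Rightarrow> real^2 \<Rightarrow> real^2 \<Rightarrow> complex \<Rightarrow> (real^2 \<Rightarrow> real)
    \<Rightarrow> complex" where
  "theta_series A a b \<tau> f =
     of_real (sqrt (Im \<tau>)) *
       (\<Sum>\<^sub>\<infinity>\<nu>\<in>lattice_coset a.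
          e2pi (quad A \<nu> * Re \<tau>) * e2pi (bilin A \<nu> b) * of_real (f (sqrt (Im \<tau>) *\<^sub>R \<nu>)))"

lemma theta_series_cong:
  assumes "\<And>\<nu>. \<nu> \<in> lattice_coset a \<Longrightarrow> f (sqrt (Im \<tau>) *\<^sub>R \<nu>) = g (sqrt (Im \<tau>) *\<^sub>R \<nu>)"
  shows "theta_series A a b \<tau> f = theta_series A a b \<tau> g"
  unfolding theta_series_def by (simp add: assms cong: infsum_cong)

lemma theta_series_add:
  assumes "(\<lambda>\<nu>. f (sqrt (Im \<tau>) *\<^sub>R \<nu>)) summable_on lattice_coset a"
    and "(\<lambda>\<nu>. g (sqrt (Im \<tau>) *\<^sub>R \<nu>)) summable_on lattice_coset a"
  shows "theta_series A a b \<tau> (\<lambda>\<nu>. f \<nu> + g \<nu>) = theta_series A a b \<tau> f + theta_series A a b \<tau> g"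
proof -
  have summable: "(\<lambda>\<nu>. e2pi (quad A \<nu> * Re \<tau>) * e2pi (bilin A \<nu> b) * complex_of_real (h \<nu>))
      summable_on lattice_coset a" if "h summable_on lattice_coset a" for h
  proof (rule abs_summable_summable)
    show "(\<lambda>\<nu>. norm (e2pi (quad A \<nu> * Re \<tau>) * e2pi (bilin A \<nu> b) * complex_of_real (h \<nu>)))
        summable_on lattice_coset a"
      using iffD1[OF summable_on_iff_abs_summable_on_real that] by (simp add: norm_mult e2pi_def)
  qed
  show ?thesis
    unfolding theta_series_def by (simp add: distrib_left infsum_add summable assms)
qed

lemma infsum_eq_theta_series:
  assumes "\<And>\<nu>. \<nu> \<in> lattice_coset a \<Longrightarrow> s * p \<nu> * r \<nu> = f (sqrt (Im \<tau>) *\<^sub>R \<nu>)"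
  shows "of_real (s * sqrt (Im \<tau>)) *
      (\<Sum>\<^sub>\<infinity>\<nu>\<in>lattice_coset a.
         of_real (p \<nu>) * e2pi (quad A \<nu> * Re \<tau>) * e2pi (bilin A \<nu> b) * of_real (r \<nu>)) =
    theta_series A a b \<tau> f"
proof -
  have "of_real s * (\<Sum>\<^sub>\<infinity>\<nu>\<in>lattice_coset a.
         of_real (p \<nu>) * e2pi (quad A \<nu> * Re \<tau>) * e2pi (bilin A \<nu> b) * of_real (r \<nu>)) =
      (\<Sum>\<^sub>\<infinity>\<nu>\<in>lattice_coset a.
         e2pi (quad A \<nu> * Re \<tau>) * e2pi (bilin A \<nu> b) * of_real (f (sqrt (Im \<tau>) *\<^sub>R \<nu>)))"
    unfolding infsum_cmult_right'[symmetric]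
    by (rule infsum_cong) (simp add: assms[symmetric])
  then show ?thesis
    by (simp add: theta_series_def mult_ac)
qed

lemma qpow_quad:
  assumes "Im \<tau> \<ge> 0"
  shows "qpow \<tau> (quad A \<nu>) =
    e2pi (quad A \<nu> * Re \<tau>) * of_real (exp (- 2 * pi * quad A (sqrt (Im \<tau>) *\<^sub>R \<nu>)))"
  using assms unfolding qpow_def e2pi_def exp_of_real[symmetric] exp_add[symmetric]
  by (intro arg_cong[where f = exp]) (simp add: complex_eq_iff quad_scaleR)

definition wall_coefficient :: "int^2^2 \<Rightarrow> real^2 \<Rightarrow> real^2 \<Rightarrow> real^2 \<Rightarrow> real" where
  "wall_coefficient A c c' \<nu> = 1 / 2 * (1 - sgn (bilin A \<nu> c * bilin A \<nu> c'))"

lemma wall_coefficient_scaleR: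
  "r \<noteq> 0 \<Longrightarrow> wall_coefficient A c c' (r *\<^sub>R \<nu>) = wall_coefficient A c c' \<nu>"
  by (cases r "0::real" rule: linorder_cases)
     (simp_all add: wall_coefficient_def bilin_scaleR sgn_mult)

subsection \<open>Hyperbolic coordinates\<close>

lemma matrix_inv_vector_mul:
  assumes "invertible (P :: real^'n^'n)"
  shows "P *v (matrix_inv P *v x) = x" "matrix_inv P *v (P *v x) = x"
proof -
  have "P ** matrix_inv P = mat 1 \<and> matrix_inv P ** P = mat 1"
    using assms unfolding invertible_def matrix_inv_def by (rule someI_ex)
  then show "P *v (matrix_inv P *v x) = x" "matrix_inv P *v (P *v x) = x"
    by (simp_all add: matrix_vector_mul_assoc)
qed

lemma c_param_c_curve:
  assumes "invertible P"
  shows "c_param P (c_curve P t) = t"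
  unfolding c_param_def
proof (rule the_equality)
  fix s assume "c_curve P s = c_curve P t"
  then have "(P *v c_curve P s) $ 1 = (P *v c_curve P t) $ 1" by simp
  then show "s = t"
    by (simp add: c_curve_def matrix_inv_vector_mul[OF assms])
qed simp

locale hyperbolic_frame =
  fixes A :: "int^2^2" and P :: "real^2^2"
  assumes invertible: "invertible P"
    and gram: "map_matrix real_of_int A = transpose P ** hyp_matrix ** P"
begin

definition u :: "real^2 \<Rightarrow> real" where
  "u \<nu> = (P *v \<nu>) $ 1"

definition v :: "real^2 \<Rightarrow> real" where
  "v \<nu> = (P *v \<nu>) $ 2"

lemma bilin_eq: "bilin A \<nu> \<mu> = u \<nu> * v \<mu> + v \<nu> * u \<mu>"
proof -
  have "bilin A \<nu> \<mu> = \<nu> \<bullet> (transpose P *v (hyp_matrix *v (P *v \<mu>)))"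
    by (simp add: bilin_def gram matrix_vector_mul_assoc matrix_mul_assoc)
  also have "\<dots> = (P *v \<nu>) \<bullet> (hyp_matrix *v (P *v \<mu>))"
    by (metis dot_lmul_matrix inner_commute transpose_matrix_vector)
  finally show ?thesis
    by (simp add: u_def v_def inner_vec_def sum_2 hyp_matrix_def matrix_vector_mult_def)
qed

lemma quad_eq: "quad A \<nu> = u \<nu> * v \<nu>"
  using bilin_eq[of \<nu> \<nu>] by (simp add: bilin_def quad_def)

lemma quad_nonzero_coords: "quad A \<nu> \<noteq> 0 \<Longrightarrow> u \<nu> \<noteq> 0" "quad A \<nu> \<noteq> 0 \<Longrightarrow> v \<nu> \<noteq> 0"
  by (auto simp: quad_eq)

lemma coords_c_curve: "u (c_curve P t) = exp t" "v (c_curve P t) = - exp (- t)"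
  by (simp_all add: u_def v_def c_curve_def matrix_inv_vector_mul[OF invertible])

lemma coords_c_perp_curve: "u (c_perp_curve P t) = exp t" "v (c_perp_curve P t) = exp (- t)"
  by (simp_all add: u_def v_def c_perp_curve_def matrix_inv_vector_mul[OF invertible])

lemma bilin_c_curve: "bilin A \<nu> (c_curve P t) = v \<nu> * exp t - u \<nu> * exp (- t)"
  by (simp add: bilin_eq coords_c_curve)

lemma bilin_c_perp_curve: "bilin A \<nu> (c_perp_curve P t) = v \<nu> * exp t + u \<nu> * exp (- t)"
  by (simp add: bilin_eq coords_c_perp_curve)

lemma coords_scaleR: "u (r *\<^sub>R \<nu>) = r * u \<nu>" "v (r *\<^sub>R \<nu>) = r * v \<nu>"
  by (simp_all add: u_def v_def matrix_vector_mult_scaleR)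

lemma norm_mult_vector_square: "(norm (P *v \<nu>))\<^sup>2 = (u \<nu>)\<^sup>2 + (v \<nu>)\<^sup>2"
  by (simp add: u_def v_def norm_vec_def L2_set_def sum_2)

lemma c_curve_ln_u:
  assumes "quad A c = -1" "u c > 0"
  shows "c_curve P (ln (u c)) = c"
proof -
  have "v c = - exp (- ln (u c))"
    using assms by (simp add: quad_eq exp_minus field_simps)
  then have "P *v c = vector [exp (ln (u c)), - exp (- ln (u c))]"
    using assms by (simp add: vec_eq_iff forall_2 u_def v_def)
  then show ?thesis
    unfolding c_curve_def by (metis matrix_inv_vector_mul(2)[OF invertible])
qed

lemma component_subset_range_c_curve:
  assumes C: "C \<in> components {c. quad A c = -1}" and base: "matrix_inv P *v vector [1, -1] \<in> C"
  shows "C \<subseteq> range (c_curve P)"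
proof
  fix c assume c: "c \<in> C"
  have hyperbola: "quad A x = -1" if "x \<in> C" for x
    using in_components_subset[OF C] that by auto
  then have "0 \<notin> u ` C"
    by (force simp: quad_eq)
  moreover have "1 \<in> u ` C"
    using base by (auto intro!: image_eqI simp: u_def matrix_inv_vector_mul[OF invertible])
  moreover have "connected (u ` C)"
    unfolding u_def using in_components_connected[OF C]
    by (intro connected_continuous_image continuous_intros matrix_vector_mult_linear_continuous_on)
  ultimately have "u c > 0"
    using connectedD_interval[of "u ` C" "u c" 1 0] c by force
  then have "c = c_curve P (ln (u c))"
    using c_curve_ln_u hyperbola[OF c] by simp
  then show "c \<in> range (c_curve P)"
    by (rule range_eqI)
qed

subsection \<open>The three terms at a lattice point\<close>

definition gauss_weight :: "real^2 \<Rightarrow> real \<Rightarrow> real" where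
  "gauss_weight \<nu> = hyp_gauss (sqrt pi * v \<nu>) (sqrt pi * u \<nu>)"

definition gauss_integral :: "real \<Rightarrow> real \<Rightarrow> real^2 \<Rightarrow> real" where
  "gauss_integral t1 t2 \<nu> = (LBINT t=t1..t2. gauss_weight \<nu> t)"

definition gauss_tail :: "real \<Rightarrow> real^2 \<Rightarrow> real" where
  "gauss_tail t \<nu> = hyp_tail (sqrt pi * v \<nu>) (sqrt pi * u \<nu>) t"

definition gauss_center :: "real^2 \<Rightarrow> real" where
  "gauss_center \<nu> = hyp_center (v \<nu>) (u \<nu>)"

definition bessel_jump :: "real \<Rightarrow> real \<Rightarrow> real^2 \<Rightarrow> real" where
  "bessel_jump t1 t2 \<nu> =
     (sgn (t2 - gauss_center \<nu>) - sgn (t1 - gauss_center \<nu>)) / 2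
       * bessel_K0 (2 * pi * \<bar>quad A \<nu>\<bar>)"

lemma gauss_integral_eq:
  assumes "quad A \<nu> \<noteq> 0"
  shows "gauss_integral t1 t2 \<nu> = bessel_jump t1 t2 \<nu> + gauss_tail t1 \<nu> - gauss_tail t2 \<nu>"
proof -
  have "\<bar>sqrt pi * v \<nu> * (sqrt pi * u \<nu>)\<bar> = \<bar>sqrt pi * sqrt pi * quad A \<nu>\<bar>"
    by (simp only: quad_eq mult_ac)
  then have "\<bar>sqrt pi * v \<nu> * (sqrt pi * u \<nu>)\<bar> = pi * \<bar>quad A \<nu>\<bar>"
    by (simp add: abs_mult)
  then show ?thesis
    using interval_integral_hyp_gauss_eq[of "sqrt pi * v \<nu>" "sqrt pi * u \<nu>" t1 t2]
      quad_nonzero_coords[OF assms]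
    by (simp add: gauss_integral_def gauss_weight_def gauss_tail_def bessel_jump_def
        gauss_center_def hyp_center_mult mult.assoc)
qed

lemma exp_bilin_c_curve:
  "exp (- pi * (bilin A \<nu> (c_curve P t))\<^sup>2) = exp (2 * pi * quad A \<nu>) * gauss_weight \<nu> t"
  using exp_minus_diff_square[of "sqrt pi * v \<nu>" t "sqrt pi * u \<nu>"]
  by (simp add: gauss_weight_def bilin_c_curve quad_eq power_mult_distrib mult_ac
      flip: right_diff_distrib)

lemma alpha_eq_gauss_tail:
  assumes "quad A \<nu> \<noteq> 0"
  shows "alpha A P t \<nu> = exp (2 * pi * quad A \<nu>) * gauss_tail t \<nu>"
proof -
  define s where "s = bilin A \<nu> (c_curve P t) * bilin A \<nu> (c_perp_curve P t)"
  have "sgn s = sgn (t - gauss_center \<nu>)"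
    unfolding s_def bilin_c_curve bilin_c_perp_curve gauss_center_def
    using quad_nonzero_coords[OF assms] by (rule sgn_exp_diff_mult_sum[rotated])
  then have "s > 0 \<longleftrightarrow> t > gauss_center \<nu>" "s < 0 \<longleftrightarrow> t < gauss_center \<nu>"
    by (auto simp: sgn_if split: if_splits)
  then show ?thesis
    unfolding alpha_def gauss_tail_def hyp_tail_def Let_def s_def[symmetric] exp_bilin_c_curve
    by (simp add: gauss_weight_def hyp_center_mult flip: gauss_center_def)
qed

subsection \<open>The coefficients of the Bessel series\<close>

lemma bessel_jump_eq:
  "bessel_jump t1 t2 \<nu> =
     sgn (t2 - t1) * (1 / 2 * (1 - sgn (t1 - gauss_center \<nu>) * sgn (t2 - gauss_center \<nu>)))
       * bessel_K0 (2 * pi * \<bar>quad A \<nu>\<bar>)"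
  using sgn_diff_times[of "t2 - gauss_center \<nu>" "t1 - gauss_center \<nu>"]
  by (simp add: bessel_jump_def)

lemma wall_coefficient_c_curve:
  assumes "quad A \<nu> \<noteq> 0"
  shows "sgn (t2 - t1) * wall_coefficient A (c_curve P t1) (c_curve P t2) \<nu>
      * bessel_K0 (2 * pi * quad A \<nu>) = (if quad A \<nu> > 0 then bessel_jump t1 t2 \<nu> else 0)"
proof -
  note nonzero = quad_nonzero_coords[OF assms]
  have "sgn (bilin A \<nu> (c_curve P t)) =
      sgn (v \<nu>) * (if quad A \<nu> > 0 then sgn (t - gauss_center \<nu>) else 1)" for t
    using sgn_exp_diff[of "v \<nu>" "u \<nu>" t] nonzero
    by (simp add: bilin_c_curve gauss_center_def quad_eq mult.commute)
  then show ?thesis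
    unfolding wall_coefficient_def sgn_mult
    by (cases "quad A \<nu> > 0") (simp_all add: sgn_mult_sgn_cancel nonzero bessel_jump_eq)
qed

lemma wall_coefficient_c_perp_curve:
  assumes "quad A \<nu> \<noteq> 0"
  shows "sgn (t2 - t1) * wall_coefficient A (c_perp_curve P t1) (c_perp_curve P t2) \<nu>
      * bessel_K0 (- 2 * pi * quad A \<nu>) = (if quad A \<nu> < 0 then bessel_jump t1 t2 \<nu> else 0)"
proof -
  note nonzero = quad_nonzero_coords[OF assms]
  have "sgn (bilin A \<nu> (c_perp_curve P t)) =
      sgn (v \<nu>) * (if quad A \<nu> < 0 then sgn (t - gauss_center \<nu>) else 1)" for t
    using sgn_exp_sum[of "v \<nu>" "u \<nu>" t] nonzero
    by (simp add: bilin_c_perp_curve gauss_center_def quad_eq mult.commute)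
  then show ?thesis
    unfolding wall_coefficient_def sgn_mult
    by (cases "quad A \<nu> < 0") (simp_all add: sgn_mult_sgn_cancel nonzero bessel_jump_eq)
qed

subsection \<open>Convergence\<close>

lemma summable_on_gaussian:
  assumes "k > 0"
  shows "(\<lambda>\<nu>. exp (- (k * ((u \<nu>)\<^sup>2 + (v \<nu>)\<^sup>2)))) summable_on lattice_coset a"
proof -
  have "inj ((*v) P)"
    using matrix_inv_vector_mul(2)[OF invertible] by (metis injI)
  then show ?thesis
    using summable_on_lattice_coset_gaussian[of "(*v) P" k a] assms
    by (simp add: norm_mult_vector_square)
qed

lemma summable_on_gauss_integral:
  assumes "r \<noteq> 0"
  shows "(\<lambda>\<nu>. gauss_integral t1 t2 (r *\<^sub>R \<nu>)) summable_on lattice_coset a"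
proof -
  define k where "k = exp (- 2 * (\<bar>t1\<bar> + \<bar>t2\<bar>)) * (pi * r\<^sup>2)"
  have "k > 0" using assms by (simp add: k_def)
  then have "(\<lambda>\<nu>. \<bar>t2 - t1\<bar> * exp (- (k * ((u \<nu>)\<^sup>2 + (v \<nu>)\<^sup>2)))) summable_on lattice_coset a"
    by (intro summable_on_cmult_right summable_on_gaussian)
  then have "(\<lambda>\<nu>. norm (gauss_integral t1 t2 (r *\<^sub>R \<nu>))) summable_on lattice_coset a"
  proof (rule Infinite_Sum.abs_summable_on_comparison_test')
    fix \<nu>
    show "norm (gauss_integral t1 t2 (r *\<^sub>R \<nu>)) \<le> \<bar>t2 - t1\<bar> * exp (- (k * ((u \<nu>)\<^sup>2 + (v \<nu>)\<^sup>2)))"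
      using abs_interval_integral_hyp_gauss_le[of t1 t2
          "sqrt pi * v (r *\<^sub>R \<nu>)" "sqrt pi * u (r *\<^sub>R \<nu>)"]
      by (simp add: gauss_integral_def gauss_weight_def k_def coords_scaleR power_mult_distrib
          algebra_simps)
  qed
  then show ?thesis
    by (rule abs_summable_summable)
qed

lemma summable_on_gauss_tail:
  assumes "r \<noteq> 0" and nonzero: "\<forall>\<nu>\<in>lattice_coset a. quad A \<nu> \<noteq> 0"
  shows "(\<lambda>\<nu>. gauss_tail t (r *\<^sub>R \<nu>)) summable_on lattice_coset a"
proof -
  define k where "k = exp (- 2 * \<bar>t\<bar>) * (pi * r\<^sup>2)"
  define M where "M \<nu> = k * ((u \<nu>)\<^sup>2 + (v \<nu>)\<^sup>2)" for \<nu>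
  have "k > 0" using assms by (simp add: k_def)
  then have "(\<lambda>\<nu>. exp (- M \<nu> / 2)) summable_on lattice_coset a"
    using summable_on_gaussian[of "k / 2" a] by (simp add: M_def)
  then show ?thesis
  proof (rule summable_on_comparison_test_small)
    fix \<nu> assume \<nu>: "\<nu> \<in> lattice_coset a" and "exp (- M \<nu> / 2) < exp (- 1 / 2)"
    then have "M \<nu> > 1" by simp
    have "\<bar>gauss_tail t (r *\<^sub>R \<nu>)\<bar> \<le> exp (- M \<nu> / 2) / M \<nu>"
      unfolding gauss_tail_def
    proof (rule abs_hyp_tail_le)
      show "sqrt pi * v (r *\<^sub>R \<nu>) \<noteq> 0" "sqrt pi * u (r *\<^sub>R \<nu>) \<noteq> 0"
        using quad_nonzero_coords[OF bspec[OF nonzero \<nu>]] assms(1) by (auto simp: coords_scaleR)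
      show "M \<nu> \<le> hyp_majorant (sqrt pi * v (r *\<^sub>R \<nu>)) (sqrt pi * u (r *\<^sub>R \<nu>)) t"
        using hyp_majorant_ge[of t "\<bar>t\<bar>" "sqrt pi * v (r *\<^sub>R \<nu>)" "sqrt pi * u (r *\<^sub>R \<nu>)"]
        by (simp add: M_def k_def coords_scaleR power_mult_distrib algebra_simps)
    qed (use \<open>M \<nu> > 1\<close> in auto)
    also have "\<dots> \<le> exp (- M \<nu> / 2) / 1"
      using \<open>M \<nu> > 1\<close> by (intro divide_left_mono) auto
    finally show "norm (gauss_tail t (r *\<^sub>R \<nu>)) \<le> exp (- M \<nu> / 2)" by simp
  qed simp
qed

lemma summable_on_bessel_jump:
  assumes "r \<noteq> 0" "\<forall>\<nu>\<in>lattice_coset a. quad A \<nu> \<noteq> 0"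
  shows "(\<lambda>\<nu>. bessel_jump t1 t2 (r *\<^sub>R \<nu>)) summable_on lattice_coset a"
proof -
  have "(\<lambda>\<nu>. gauss_integral t1 t2 (r *\<^sub>R \<nu>) + gauss_tail t2 (r *\<^sub>R \<nu>) + - gauss_tail t1 (r *\<^sub>R \<nu>))
      summable_on lattice_coset a"
    using assms by (intro summable_on_add summable_on_uminus[THEN iffD2]
        summable_on_gauss_integral summable_on_gauss_tail)
  then show ?thesis
    by (rule summable_on_cong[THEN iffD1, rotated])
       (use assms in \<open>simp add: gauss_integral_eq quad_scaleR\<close>)
qed

lemma summable_on_bessel_jump_if:
  assumes "r \<noteq> 0" "\<forall>\<nu>\<in>lattice_coset a. quad A \<nu> \<noteq> 0"
  shows "(\<lambda>\<nu>. if p (quad A (r *\<^sub>R \<nu>)) then bessel_jump t1 t2 (r *\<^sub>R \<nu>) else 0)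
    summable_on lattice_coset a"
proof -
  have "(\<lambda>\<nu>. bessel_jump t1 t2 (r *\<^sub>R \<nu>)) summable_on {\<nu> \<in> lattice_coset a. p (quad A (r *\<^sub>R \<nu>))}"
    by (rule summable_on_subset[OF summable_on_bessel_jump[OF assms]]) auto
  then show ?thesis
    by (rule summable_on_cong_neutral[THEN iffD1, rotated -1]) auto
qed

subsection \<open>The indefinite theta series\<close>

lemma Phi_hat_eq_theta_series:
  assumes "Im \<tau> \<ge> 0"
  shows "Phi_hat A P a b (c_curve P t1) (c_curve P t2) \<tau> =
    theta_series A a b \<tau> (gauss_integral t1 t2)"
proof -
  have weight: "(LBINT t=t1..t2. exp (- pi * Im \<tau> * (bilin A \<nu> (c_curve P t))\<^sup>2)) =
      exp (2 * pi * quad A (sqrt (Im \<tau>) *\<^sub>R \<nu>)) * gauss_integral t1 t2 (sqrt (Im \<tau>) *\<^sub>R \<nu>)" for \<nu>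
  proof -
    have "exp (- pi * Im \<tau> * (bilin A \<nu> (c_curve P t))\<^sup>2) =
        exp (- pi * (bilin A (sqrt (Im \<tau>) *\<^sub>R \<nu>) (c_curve P t))\<^sup>2)" for t
      using assms by (simp add: bilin_scaleR power_mult_distrib mult.assoc)
    then show ?thesis
      unfolding exp_bilin_c_curve by (simp add: gauss_integral_def)
  qed
  show ?thesis
    unfolding Phi_hat_def theta_series_def c_param_c_curve[OF invertible] weight qpow_quad[OF assms]
    by (rule arg_cong2[where f = "(*)", OF refl], rule infsum_cong)
       (simp add: exp_minus field_simps)
qed

lemma phi_eq_theta_series:
  assumes "Im \<tau> > 0" and nonzero: "\<forall>\<nu>\<in>lattice_coset a. quad A \<nu> \<noteq> 0"
  shows "phi A P a b (c_curve P t) \<tau> = theta_series A a b \<tau> (gauss_tail t)"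
proof -
  have "of_real (alpha A P t (sqrt (Im \<tau>) *\<^sub>R \<nu>)) * qpow \<tau> (quad A \<nu>) * e2pi (bilin A \<nu> b) =
      e2pi (quad A \<nu> * Re \<tau>) * e2pi (bilin A \<nu> b) * of_real (gauss_tail t (sqrt (Im \<tau>) *\<^sub>R \<nu>))"
    if "\<nu> \<in> lattice_coset a" for \<nu>
    using assms that
    by (simp add: alpha_eq_gauss_tail quad_scaleR[of A "sqrt _"] qpow_quad exp_minus field_simps)
  then show ?thesis
    unfolding phi_def theta_series_def c_param_c_curve[OF invertible]
    by (simp only: cong: infsum_cong)
qed

lemma Phi_eq_theta_series:
  assumes "Im \<tau> > 0" and nonzero: "\<forall>\<nu>\<in>lattice_coset a. quad A \<nu> \<noteq> 0"
  shows "Phi A P a b (c_curve P t1) (c_curve P t2) \<tau> = theta_series A a b \<tau> (bessel_jump t1 t2)"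
proof -
  let ?pos = "\<lambda>\<nu>. if quad A \<nu> > 0 then bessel_jump t1 t2 \<nu> else 0"
  let ?neg = "\<lambda>\<nu>. if quad A \<nu> < 0 then bessel_jump t1 t2 \<nu> else 0"
  have "Phi A P a b (c_curve P t1) (c_curve P t2) \<tau> =
      theta_series A a b \<tau> ?pos + theta_series A a b \<tau> ?neg"
    unfolding Phi_def c_perp_def c_param_c_curve[OF invertible] wall_coefficient_def[symmetric]
  proof (intro arg_cong2[where f = "(+)"] infsum_eq_theta_series)
    fix \<nu> assume "\<nu> \<in> lattice_coset a"
    let ?\<mu> = "sqrt (Im \<tau>) *\<^sub>R \<nu>"
    have quad: "quad A ?\<mu> = quad A \<nu> * Im \<tau>"
      using assms(1) by (simp add: quad_scaleR)
    then have nz: "quad A ?\<mu> \<noteq> 0"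
      using assms \<open>\<nu> \<in> lattice_coset a\<close> by simp
    note coefficients = wall_coefficient_c_curve[OF nz, of t2 t1]
      wall_coefficient_c_perp_curve[OF nz, of t2 t1]
      wall_coefficient_scaleR[of "sqrt (Im \<tau>)" A _ _ \<nu>]
    show "sgn (t2 - t1) * wall_coefficient A (c_curve P t1) (c_curve P t2) \<nu> *
        bessel_K0 (2 * pi * quad A \<nu> * Im \<tau>) = ?pos ?\<mu>"
      using coefficients assms(1) by (simp add: quad mult.assoc)
    show "sgn (t2 - t1) * wall_coefficient A (c_perp_curve P t1) (c_perp_curve P t2) \<nu> *
        bessel_K0 (- 2 * pi * quad A \<nu> * Im \<tau>) = ?neg ?\<mu>"
      using coefficients assms(1) by (simp add: quad mult.assoc)
  qed
  also have "\<dots> = theta_series A a b \<tau> (\<lambda>\<nu>. ?pos \<nu> + ?neg \<nu>)"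
    using assms by (intro theta_series_add[symmetric] summable_on_bessel_jump_if) auto
  also have "\<dots> = theta_series A a b \<tau> (bessel_jump t1 t2)"
    using assms
    by (intro theta_series_cong) (auto simp: quad_scaleR zero_less_mult_iff mult_less_0_iff)
  finally show ?thesis .
qed

end

theorem theorem2:
  fixes A :: "int^2^2" and P :: "real^2^2" and C\<^sub>Q :: "(real^2) set"
    and a b c1 c2 :: "real^2"
  assumes "transpose A = A"
    and "has_signature (quad A) 1 1"
    and "C\<^sub>Q \<in> components {c. quad A c = -1}"
    and "invertible P"
    and "map_matrix real_of_int A = transpose P ** hyp_matrix ** P"
    and "matrix_inv P *v vector [1, -1] \<in> C\<^sub>Q"
    and "c1 \<in> C\<^sub>Q" and "c2 \<in> C\<^sub>Q"
    and "\<forall>\<nu>\<in>lattice_coset a. quad A \<nu> \<noteq> 0"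
  shows "\<forall>\<tau>. Im \<tau> > 0 \<longrightarrow>
           Phi_hat A P a b c1 c2 \<tau> = Phi A P a b c1 c2 \<tau> + phi A P a b c1 \<tau> - phi A P a b c2 \<tau>"
proof (intro allI impI)
  fix \<tau> :: complex assume \<tau>: "Im \<tau> > 0"
  interpret hyperbolic_frame A P
    using assms(4,5) by unfold_locales
  obtain t1 t2 where c: "c1 = c_curve P t1" "c2 = c_curve P t2"
    using component_subset_range_c_curve[OF assms(3,6)] assms(7,8) by blast
  note series = Phi_hat_eq_theta_series Phi_eq_theta_series phi_eq_theta_series
  let ?S = "theta_series A a b \<tau>"
  have y: "sqrt (Im \<tau>) \<noteq> 0" using \<tau> by simp
  note summable = summable_on_gauss_integral[OF y] summable_on_gauss_tail[OF y assms(9)]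
    summable_on_bessel_jump[OF y assms(9)]
  have "?S (gauss_integral t1 t2) + ?S (gauss_tail t2) =
      ?S (\<lambda>\<nu>. gauss_integral t1 t2 \<nu> + gauss_tail t2 \<nu>)"
    by (intro theta_series_add[symmetric] summable)
  also have "\<dots> = ?S (\<lambda>\<nu>. bessel_jump t1 t2 \<nu> + gauss_tail t1 \<nu>)"
    using \<tau> assms(9) by (intro theta_series_cong) (simp add: gauss_integral_eq quad_scaleR)
  also have "\<dots> = ?S (bessel_jump t1 t2) + ?S (gauss_tail t1)"
    by (intro theta_series_add summable)
  finally show "Phi_hat A P a b c1 c2 \<tau> = Phi A P a b c1 c2 \<tau> + phi A P a b c1 \<tau> - phi A P a b c2 \<tau>"
    using \<tau> assms(9) by (simp add: c series algebra_simps)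
qed

end
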